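(* Let $q\ge 2$ and $n\ge 1$ be integers, and let $f$ be a formal Fourier series on $\mathbb{T}$. Then the equality of operator norms $$\|\Gamma_q^{(n)}[f]\|=\|T_n(f)\|$$ holds in any of the following three cases: (A1) $\widehat f(k)\ge 0$ for all integers $k$ with $|k|\le n$; (A2) the finite Toeplitz matrix $T_n(f)$ (and thus the matrix $\Gamma_q^{(n)}[f]$) is Hermitian; (A3) $f\in H^\infty(\mathbb{T})$.
   Context: $T_q$ denotes the (vertex set of the) infinite rooted $q$-homogeneous tree: there is a root $o$, and each vertex has exactly $q$ children. $d$ is the graph distance and $|\sigma| := d(o,\sigma)$. Two vertices are comparable if they lie on a common geodesic ray starting at the root; $\mathcal{C}\subset T_q\times T_q$ is the set of comparable pairs, with indicator $\mathbf{1}_{\mathcal{C}}$. $\mathbb{B}_n(T_q)=\{\sigma\in T_q:|\sigma|\le n\}$. $\mathbb{T}=\mathbb{R}/2\pi\mathbb{Z}$. A formal Fourier series $f\sim\sum_{n\in\mathbb{Z}}\widehat f(n)e^{in\theta}$ is an arbitrary sequence $(\widehat f(n))_{n\in\mathbb{Z}}$ of complex numbers; a function $f\in L^1(\mathbb{T})$ is identified with the series with coefficients $\widehat f(n)=\int_{\mathbb{T}} f(e^{i\theta})e^{-in\theta}\frac{d\theta}{2\pi}$. $H^\infty(\mathbb{T})=\{f\in L^\infty(\mathbb{T}):\widehat f(n)=0\text{ for all }n<0\}$. $\Gamma_q[f](\sigma_1,\sigma_2) := q^{-d(\sigma_1,\sigma_2)/2}\,\widehat f(|\sigma_1|-|\sigma_2|)\,\mathbf{1}_{\mathcal{C}}(\sigma_1,\sigma_2)$,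 and $\Gamma_q^{(n)}[f]$ is the restriction of $\Gamma_q[f]$ to $\mathbb{B}_n(T_q)\times\mathbb{B}_n(T_q)$, a finite matrix acting on $\mathbb{C}^{\mathbb{B}_n(T_q)}$. $T_n(f)=[\widehat f(k-l)]_{0\le k,l\le n}$. Matrix norms are operator norms with respect to Euclidean norms. *)

theory Defs
  imports "HOL-Analysis.Analysis"
begin

text \<open>A vertex is the word of child labels met on the way down from the root \<^term>\<open>[]\<close>.\<close>

definition tree :: "nat \<Rightarrow> nat list set" where
  "tree q = lists {..<q}"

definition tree_edges :: "nat \<Rightarrow> (nat list \<times> nat list) set" where
  "tree_edges q = {(\<sigma>, \<tau>). \<sigma> \<in> tree q \<and> \<tau> \<in> tree q \<and>
     ((\<exists>i<q. \<tau> = \<sigma> @ [i]) \<or> (\<exists>i<q. \<sigma> = \<tau> @ [i]))}"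

text \<open>Graph distance: length of a shortest walk. It is meaningful for two vertices of
  \<^term>\<open>tree q\<close>, which is connected.\<close>

definition tree_dist :: "nat \<Rightarrow> nat list \<Rightarrow> nat list \<Rightarrow> nat" where
  "tree_dist q \<sigma> \<tau> = (LEAST m. (\<sigma>, \<tau>) \<in> tree_edges q ^^ m)"

definition level :: "nat \<Rightarrow> nat list \<Rightarrow> nat" where
  "level q \<sigma> = tree_dist q [] \<sigma>"

definition tree_ball :: "nat \<Rightarrow> nat \<Rightarrow> nat list set" where
  "tree_ball q n = {\<sigma> \<in> tree q. level q \<sigma> \<le> n}"

definition geodesic_ray :: "nat \<Rightarrow> (nat \<Rightarrow> nat list) \<Rightarrow> bool" where
  "geodesic_ray q x \<longleftrightarrow> x 0 = [] \<and> (\<forall>i. x i \<in> tree q) \<and>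
     (\<forall>i j. int (tree_dist q (x i) (x j)) = \<bar>int i - int j\<bar>)"

definition comparable :: "nat \<Rightarrow> (nat list \<times> nat list) set" where
  "comparable q = {(\<sigma>, \<tau>). \<exists>x. geodesic_ray q x \<and> \<sigma> \<in> range x \<and> \<tau> \<in> range x}"

text \<open>A square matrix with finite index set \<open>I\<close> is a function of two indices of which only
  the values on \<open>I \<times> I\<close> matter; likewise for vectors. The supremum below is taken over a
  nonempty set which is bounded above because \<open>I\<close> is finite.\<close>

definition mat_apply :: "'i set \<Rightarrow> ('i \<Rightarrow> 'i \<Rightarrow> complex) \<Rightarrow> ('i \<Rightarrow> complex) \<Rightarrow> 'i \<Rightarrow> complex" where
  "mat_apply I A x i = (\<Sum>j\<in>I. A i j * x j)"

definition euclid_norm :: "'i set \<Rightarrow> ('i \<Rightarrow> complex) \<Rightarrow> real" where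
  "euclid_norm I x = L2_set (\<lambda>i. norm (x i)) I"

definition op_norm :: "'i set \<Rightarrow> ('i \<Rightarrow> 'i \<Rightarrow> complex) \<Rightarrow> real" where
  "op_norm I A = Sup {euclid_norm I (mat_apply I A x) | x. euclid_norm I x \<le> 1}"

definition hermitian_on :: "'i set \<Rightarrow> ('i \<Rightarrow> 'i \<Rightarrow> complex) \<Rightarrow> bool" where
  "hermitian_on I A \<longleftrightarrow> (\<forall>i\<in>I. \<forall>j\<in>I. A j i = cnj (A i j))"

text \<open>A formal Fourier series is its coefficient sequence.\<close>

type_synonym fourier_series = "int \<Rightarrow> complex"

text \<open>Functions on the circle are given by their values at \<^term>\<open>cis \<theta>\<close>; values off the unit
  circle are irrelevant.\<close>

definition fourier_coeff :: "(complex \<Rightarrow> complex) \<Rightarrow> fourier_series" where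
  "fourier_coeff g n =
     (LINT \<theta>:{0..2*pi}|lebesgue. g (cis \<theta>) * cis (- (of_int n * \<theta>))) / of_real (2 * pi)"

definition L_infty_circle :: "(complex \<Rightarrow> complex) set" where
  "L_infty_circle = {g. (\<lambda>\<theta>. g (cis \<theta>)) \<in> borel_measurable lebesgue \<and>
     (\<exists>C::real. AE \<theta> in lebesgue. norm (g (cis \<theta>)) \<le> C)}"

definition H_infty :: "fourier_series set" where
  "H_infty = {fourier_coeff g | g. g \<in> L_infty_circle \<and> (\<forall>n<0. fourier_coeff g n = 0)}"

definition toeplitz :: "fourier_series \<Rightarrow> nat \<Rightarrow> nat \<Rightarrow> complex" where
  "toeplitz f k l = f (int k - int l)"

definition Gamma_tree :: "nat \<Rightarrow> fourier_series \<Rightarrow> nat list \<Rightarrow> nat list \<Rightarrow> complex" where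
  "Gamma_tree q f \<sigma> \<tau> =
     of_real (real q powr (- (real (tree_dist q \<sigma> \<tau>) / 2))) *
     f (int (level q \<sigma>) - int (level q \<tau>)) * indicator (comparable q) (\<sigma>, \<tau>)"

end

theory Submission
  imports Defs "HOL-Library.Sublist"
begin

text \<open>
  Write \<open>\<Gamma>\<close> for the tree matrix on the ball of radius \<open>n\<close> and \<open>T\<^sub>m\<close> for the Toeplitz matrix
  on \<open>{0..m}\<close>. The matrix \<open>\<Gamma>\<close> is unitarily equivalent to an orthogonal sum of \<open>T\<^sub>n\<close> and
  of copies of the truncations \<open>T\<^sub>m\<close> with \<open>m < n\<close>. As a corner of \<open>T\<^sub>n\<close>, each \<open>T\<^sub>m\<close> has
  norm at most that of \<open>T\<^sub>n\<close>, so \<open>\<Gamma>\<close> and \<open>T\<^sub>n\<close> have the same norm.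

  The summand \<open>T\<^sub>n\<close> is the action of \<open>\<Gamma>\<close> on radial vectors: the weight \<open>q\<^bsup>-d/2\<^esup>\<close> is
  exactly what makes \<open>x \<mapsto> q\<^bsup>-|\<sigma>|/2\<^esup> x(|\<sigma>|)\<close> an isometry that intertwines \<open>T\<^sub>n\<close> with
  \<open>\<Gamma>\<close>. The other summands sit at the vertices \<open>v\<close> with \<open>|v| < n\<close>: a vector which is radial
  below each child \<open>v @ [i]\<close>, with profile \<open>c i * x\<close> for one \<open>x\<close> and scalars \<open>c i\<close>
  of sum zero, is mapped to a vector of the same kind with profile \<open>c i * T\<^sub>m x\<close>, where
  \<open>m = n - |v| - 1\<close>, because \<open>v\<close> and its ancestors see only the sum over the children,
  which vanishes.

  Instead of building this decomposition, the proof splits the square norm along it.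
  The adjoint of the isometry above takes a vector to its normalized level sums
  (\<open>level_sum\<close>) and intertwines \<open>\<Gamma>\<close> with \<open>T\<^sub>n\<close> too (\<open>level_sum_Gamma_apply\<close>). The square
  norm left over, \<open>nonradial_energy\<close>, is by the variance identity a sum over the first
  letters \<open>i\<close> of the same quantity for the subtree below \<open>i\<close> and of the squared deviation
  of the level sums of this subtree from their mean over all first letters
  (\<open>nonradial_energy_Suc\<close>). An induction on the radius
  (\<open>nonradial_energy_Gamma_le\<close>) then bounds the energy of \<open>\<Gamma> X\<close> by that of \<open>X\<close>
  times a common bound of the squared norms of the truncations.
\<close>

section \<open>Distances and comparability in terms of words\<close>

lemma tree_edges_sym: "(\<sigma>, \<tau>) \<in> tree_edges q \<Longrightarrow> (\<tau>, \<sigma>) \<in> tree_edges q"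
  by (auto simp: tree_edges_def)

lemma walk_sym: "(\<sigma>, \<tau>) \<in> tree_edges q ^^ m \<Longrightarrow> (\<tau>, \<sigma>) \<in> tree_edges q ^^ m"
proof (induction m arbitrary: \<tau>)
  case 0
  then show ?case by simp
next
  case (Suc m)
  then obtain \<rho> where "(\<sigma>, \<rho>) \<in> tree_edges q ^^ m" "(\<rho>, \<tau>) \<in> tree_edges q" by auto
  then show ?case
    using Suc.IH tree_edges_sym relpow_Suc_I2 by metis
qed

lemma tree_dist_commute: "tree_dist q \<sigma> \<tau> = tree_dist q \<tau> \<sigma>"
  unfolding tree_dist_def using walk_sym by metis

lemma walk_length:
  "(\<sigma>, \<tau>) \<in> tree_edges q ^^ m \<Longrightarrow> \<bar>int (length \<sigma>) - int (length \<tau>)\<bar> \<le> int m"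
proof (induction m arbitrary: \<tau>)
  case 0
  then show ?case by simp
next
  case (Suc m)
  then obtain \<rho> where "(\<sigma>, \<rho>) \<in> tree_edges q ^^ m" "(\<rho>, \<tau>) \<in> tree_edges q" by auto
  then show ?case
    using Suc.IH[of \<rho>] by (auto simp: tree_edges_def)
qed

lemma walk_append:
  "\<sigma> @ \<rho> \<in> tree q \<Longrightarrow> (\<sigma>, \<sigma> @ \<rho>) \<in> tree_edges q ^^ length \<rho>"
proof (induction \<rho> rule: rev_induct)
  case Nil
  then show ?case by simp
next
  case (snoc i \<rho>)
  then have "(\<sigma>, \<sigma> @ \<rho>) \<in> tree_edges q ^^ length \<rho>"
    by (auto simp: tree_def)
  moreover have "(\<sigma> @ \<rho>, \<sigma> @ \<rho> @ [i]) \<in> tree_edges q"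
    using snoc.prems by (auto simp: tree_def tree_edges_def)
  ultimately show ?case by auto
qed

lemma tree_dist_append:
  assumes "\<sigma> @ \<rho> \<in> tree q"
  shows "tree_dist q \<sigma> (\<sigma> @ \<rho>) = length \<rho>"
  unfolding tree_dist_def
proof (rule Least_equality)
  show "(\<sigma>, \<sigma> @ \<rho>) \<in> tree_edges q ^^ length \<rho>" using walk_append[OF assms] .
next
  fix m assume "(\<sigma>, \<sigma> @ \<rho>) \<in> tree_edges q ^^ m"
  then show "length \<rho> \<le> m" using walk_length by fastforce
qed

lemma level_eq_length: "\<sigma> \<in> tree q \<Longrightarrow> level q \<sigma> = length \<sigma>"
  using tree_dist_append[of "[]" \<sigma> q] by (simp add: level_def)

text \<open>Walking up to the root and down again shows that the minimum which defines the
  distance is attained; for unconnected vertices it would carry no information.\<close>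

lemma walk_exists:
  assumes "\<sigma> \<in> tree q" "\<tau> \<in> tree q"
  shows "(\<sigma>, \<tau>) \<in> tree_edges q ^^ tree_dist q \<sigma> \<tau>"
proof -
  have "(\<sigma>, []) \<in> tree_edges q ^^ length \<sigma>" "([], \<tau>) \<in> tree_edges q ^^ length \<tau>"
    using walk_append[of "[]" \<sigma> q] walk_append[of "[]" \<tau> q] assms walk_sym by auto
  then have "(\<sigma>, \<tau>) \<in> tree_edges q ^^ (length \<sigma> + length \<tau>)"
    by (auto simp: relpow_add)
  then show ?thesis unfolding tree_dist_def by (rule LeastI)
qed

text \<open>Consecutive vertices of a ray are adjacent and the second one is deeper, so it extends
  the first one by a letter.\<close>

lemma geodesic_ray_prefix:
  assumes ray: "geodesic_ray q x" and "i \<le> j"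
  shows "prefix (x i) (x j)"
proof -
  have inT: "x k \<in> tree q" for k using ray by (simp add: geodesic_ray_def)
  have len: "length (x k) = k" for k
  proof -
    have "int (tree_dist q (x 0) (x k)) = int k"
      using ray unfolding geodesic_ray_def by (metis abs_of_nat abs_minus_commute diff_0_right of_nat_0)
    then show ?thesis
      using ray level_eq_length[OF inT, of k] by (simp add: geodesic_ray_def level_def)
  qed
  have step: "prefix (x k) (x (Suc k))" for k
  proof -
    have "int (tree_dist q (x k) (x (Suc k))) = \<bar>int k - int (Suc k)\<bar>"
      using ray unfolding geodesic_ray_def by blast
    then have "tree_dist q (x k) (x (Suc k)) = 1" by simp
    then have "(x k, x (Suc k)) \<in> tree_edges q"
      using walk_exists[OF inT inT, of k "Suc k"] by simp
    then show ?thesis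
      using len[of k] len[of "Suc k"] by (auto simp: tree_edges_def)
  qed
  show ?thesis
    using \<open>i \<le> j\<close>
  proof (induction rule: dec_induct)
    case base
    then show ?case by simp
  next
    case (step k)
    then show ?case using \<open>\<And>k. prefix (x k) (x (Suc k))\<close> prefix_order.trans by blast
  qed
qed

text \<open>A word is completed to a ray by repeatedly taking the child labelled \<open>0\<close>.\<close>

lemma geodesic_ray_through:
  assumes "q \<ge> 1" "\<tau> \<in> tree q"
  shows "geodesic_ray q (\<lambda>i. take i (\<tau> @ replicate i 0))" (is "geodesic_ray q ?x")
proof -
  have inT: "?x i \<in> tree q" for i
    using assms by (auto simp: tree_def dest!: in_set_takeD)
  have len: "length (?x i) = i" for i by simp
  have dist: "tree_dist q (?x i) (?x j) = j - i" if "i \<le> j" for i j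
  proof -
    have "?x i = take i (?x j)"
      using that by (simp add: min_def)
    then have eq: "?x j = ?x i @ drop i (?x j)"
      by (metis append_take_drop_id)
    have "tree_dist q (?x i) (?x j) = length (drop i (?x j))"
      using tree_dist_append[of "?x i" "drop i (?x j)" q] eq inT[of j] by metis
    also have "\<dots> = j - i" by (simp only: length_drop len)
    finally show ?thesis .
  qed
  have "int (tree_dist q (?x i) (?x j)) = \<bar>int i - int j\<bar>" for i j
  proof (cases "i \<le> j")
    case True
    then show ?thesis unfolding dist[OF True] by simp
  next
    case False
    then have "j \<le> i" by simp
    then show ?thesis unfolding tree_dist_commute[of q "?x i"] dist[OF \<open>j \<le> i\<close>] by simp
  qed
  then show ?thesis using inT by (simp add: geodesic_ray_def)
qed

lemma comparable_iff_prefix: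
  assumes "q \<ge> 1" "\<sigma> \<in> tree q" "\<tau> \<in> tree q"
  shows "(\<sigma>, \<tau>) \<in> comparable q \<longleftrightarrow> prefix \<sigma> \<tau> \<or> prefix \<tau> \<sigma>"
proof
  assume "(\<sigma>, \<tau>) \<in> comparable q"
  then obtain x i j where "geodesic_ray q x" "\<sigma> = x i" "\<tau> = x j"
    by (auto simp: comparable_def)
  then show "prefix \<sigma> \<tau> \<or> prefix \<tau> \<sigma>"
    using geodesic_ray_prefix by (metis nle_le)
next
  have *: "\<exists>x. geodesic_ray q x \<and> \<alpha> \<in> range x \<and> \<beta> \<in> range x"
    if pre: "prefix \<alpha> \<beta>" and \<beta>: "\<beta> \<in> tree q" for \<alpha> \<beta>
  proof -
    obtain \<rho> where \<rho>: "\<beta> = \<alpha> @ \<rho>" using pre by (auto simp: prefix_def)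
    let ?x = "\<lambda>i. take i (\<beta> @ replicate i 0)"
    have "\<alpha> = ?x (length \<alpha>)" "\<beta> = ?x (length \<beta>)" using \<rho> by simp_all
    then have "\<alpha> \<in> range ?x" "\<beta> \<in> range ?x" by blast+
    then show ?thesis using geodesic_ray_through[OF assms(1) \<beta>] by blast
  qed
  assume "prefix \<sigma> \<tau> \<or> prefix \<tau> \<sigma>"
  then show "(\<sigma>, \<tau>) \<in> comparable q"
    using *[of \<sigma> \<tau>] *[of \<tau> \<sigma>] assms by (auto simp: comparable_def)
qed

section \<open>The tree matrix along the first letter\<close>

text \<open>The factor \<open>q\<^bsup>-1/2\<^esup>\<close> that one generation contributes to an entry of the tree
  matrix.\<close>

definition level_weight :: "nat \<Rightarrow> complex" where
  "level_weight q = of_real (1 / sqrt (real q))"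

lemma level_weight_square:
  "q \<ge> 1 \<Longrightarrow> of_nat q * (level_weight q * level_weight q) = 1"
proof -
  assume "q \<ge> 1"
  then have "real q * (1 / sqrt (real q) * (1 / sqrt (real q))) = 1" by simp
  then have "complex_of_real (real q * (1 / sqrt (real q) * (1 / sqrt (real q)))) = 1" by simp
  then show ?thesis unfolding level_weight_def by (metis of_real_mult of_real_of_nat_eq)
qed

lemma powr_eq_level_weight_power:
  assumes "q \<ge> 1"
  shows "complex_of_real (real q powr (- (real d / 2))) = level_weight q ^ d"
proof -
  have "real q powr (- (real d / 2)) = (real q powr (-(1/2))) powr real d"
    by (simp add: powr_powr)
  also have "real q powr (-(1/2)) = 1 / sqrt (real q)"
    using powr_minus_divide[of "real q" "1/2"] by (simp add: powr_half_sqrt)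
  also have "(1 / sqrt (real q)) powr real d = (1 / sqrt (real q)) ^ d"
    using assms by (simp add: powr_realpow)
  finally show ?thesis by (simp add: level_weight_def)
qed

lemma Gamma_tree_prefix:
  assumes "q \<ge> 1" "\<sigma> \<in> tree q" "\<tau> \<in> tree q"
  shows "Gamma_tree q f \<sigma> \<tau> =
    (if prefix \<sigma> \<tau> \<or> prefix \<tau> \<sigma>
     then level_weight q ^ nat \<bar>int (length \<sigma>) - int (length \<tau>)\<bar> *
          f (int (length \<sigma>) - int (length \<tau>))
     else 0)"
proof -
  have d: "tree_dist q \<alpha> \<beta> = nat \<bar>int (length \<alpha>) - int (length \<beta>)\<bar>"
    if "prefix \<alpha> \<beta>" "\<beta> \<in> tree q" for \<alpha> \<beta>
    using that by (auto simp: prefix_def tree_dist_append)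
  have "tree_dist q \<sigma> \<tau> = nat \<bar>int (length \<sigma>) - int (length \<tau>)\<bar>"
    if "prefix \<sigma> \<tau> \<or> prefix \<tau> \<sigma>"
    using that d[of \<sigma> \<tau>] d[of \<tau> \<sigma>] assms tree_dist_commute[of q \<sigma> \<tau>]
    by (auto simp: abs_minus_commute)
  then show ?thesis
    using assms
    by (simp add: Gamma_tree_def comparable_iff_prefix level_eq_length
        powr_eq_level_weight_power indicator_def)
qed

lemma Nil_in_tree [simp]: "[] \<in> tree q"
  by (simp add: tree_def)

lemma Cons_in_tree [simp]: "i # w \<in> tree q \<longleftrightarrow> i < q \<and> w \<in> tree q"
  by (simp add: tree_def)

lemma tree_ball_length: "tree_ball q n = {w \<in> tree q. length w \<le> n}"
  by (auto simp: tree_ball_def level_eq_length)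

lemma finite_tree_ball [simp]: "finite (tree_ball q n)"
  using finite_lists_length_le[of "{..<q}" n]
  by (simp add: tree_ball_length tree_def lists_eq_set conj_commute)

lemma Nil_in_tree_ball [simp]: "[] \<in> tree_ball q n"
  by (simp add: tree_ball_length)

lemma Cons_in_tree_ball [simp]: "i # w \<in> tree_ball q (Suc n) \<longleftrightarrow> i < q \<and> w \<in> tree_ball q n"
  by (auto simp: tree_ball_length)

lemma tree_ball_0: "tree_ball q 0 = {[]}"
  by (auto simp: tree_ball_length)

lemma sum_tree_ball_Suc:
  fixes g :: "nat list \<Rightarrow> 'a::comm_monoid_add"
  shows "sum g (tree_ball q (Suc n)) = g [] + (\<Sum>i<q. \<Sum>w\<in>tree_ball q n. g (i # w))"
proof -
  let ?h = "\<lambda>(i, w). i # w"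
  have split: "tree_ball q (Suc n) = insert [] (?h ` ({..<q} \<times> tree_ball q n))"
  proof (intro equalityI subsetI)
    fix u assume "u \<in> tree_ball q (Suc n)"
    then show "u \<in> insert [] (?h ` ({..<q} \<times> tree_ball q n))"
      by (cases u) (auto simp: image_iff)
  qed auto
  have "sum g (tree_ball q (Suc n)) = g [] + sum g (?h ` ({..<q} \<times> tree_ball q n))"
    unfolding split by (rule sum.insert) auto
  also have "sum g (?h ` ({..<q} \<times> tree_ball q n)) = (\<Sum>(i, w)\<in>{..<q} \<times> tree_ball q n. g (i # w))"
    by (subst sum.reindex) (auto simp: inj_on_def intro!: sum.cong)
  also have "\<dots> = (\<Sum>i<q. \<Sum>w\<in>tree_ball q n. g (i # w))"
    by (simp add: sum.cartesian_product)
  finally show ?thesis .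
qed

definition Gamma_apply :: "nat \<Rightarrow> fourier_series \<Rightarrow> nat \<Rightarrow> (nat list \<Rightarrow> complex) \<Rightarrow> nat list \<Rightarrow> complex"
  where "Gamma_apply q f n = mat_apply (tree_ball q n) (Gamma_tree q f)"

text \<open>Below the first letter \<open>i\<close> the matrix is a copy of the one of smaller radius. Other first
  letters are not comparable, and the root contributes a radial term which does not depend
  on \<open>i\<close>; this independence is what the later induction uses.\<close>

lemma Gamma_apply_Cons:
  assumes "q \<ge> 1" "i < q" "w \<in> tree_ball q n"
  shows "Gamma_apply q f (Suc n) X (i # w) =
    Gamma_apply q f n (\<lambda>u. X (i # u)) w +
    level_weight q ^ Suc (length w) * (f (1 + int (length w)) * X [])"
proof -
  have w: "w \<in> tree q" using assms(3) by (simp add: tree_ball_length)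
  have child: "Gamma_tree q f (i # w) (j # u) = (if j = i then Gamma_tree q f w u else 0)"
    if "j < q" "u \<in> tree_ball q n" for j u
  proof -
    have "u \<in> tree q" using that by (simp add: tree_ball_length)
    then show ?thesis using assms(1,2) w that by (auto simp: Gamma_tree_prefix)
  qed
  have root: "Gamma_tree q f (i # w) [] = level_weight q ^ Suc (length w) * f (1 + int (length w))"
  proof -
    have "nat \<bar>1 + int (length w)\<bar> = Suc (length w)" by simp
    then show ?thesis using assms(1,2) w by (simp add: Gamma_tree_prefix)
  qed
  have "(\<Sum>j<q. \<Sum>u\<in>tree_ball q n. Gamma_tree q f (i # w) (j # u) * X (j # u)) =
    (\<Sum>j<q. if j = i then (\<Sum>u\<in>tree_ball q n. Gamma_tree q f w u * X (i # u)) else 0)"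
    using child by (intro sum.cong) auto
  also have "\<dots> = (\<Sum>u\<in>tree_ball q n. Gamma_tree q f w u * X (i # u))"
    using assms(2) by simp
  finally show ?thesis
    by (simp add: Gamma_apply_def mat_apply_def sum_tree_ball_Suc root)
qed

section \<open>Normalized level sums\<close>

text \<open>This is \<open>q\<^bsup>-k/2\<^esup>\<close> times the sum of \<open>X\<close> over the words of length \<open>k\<close>, that is, the
  inner product of \<open>X\<close> with the unit vector constant on level \<open>k\<close>. The recursion follows
  the first letter, as does \<open>Gamma_apply_Cons\<close>.\<close>

fun level_sum :: "nat \<Rightarrow> nat \<Rightarrow> (nat list \<Rightarrow> complex) \<Rightarrow> complex" where
  "level_sum q 0 X = X []"
| "level_sum q (Suc k) X = level_weight q * (\<Sum>i<q. level_sum q k (\<lambda>w. X (i # w)))"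

lemma level_sum_cong:
  "(\<And>w. w \<in> tree_ball q n \<Longrightarrow> X w = Y w) \<Longrightarrow> k \<le> n \<Longrightarrow> level_sum q k X = level_sum q k Y"
proof (induction k arbitrary: n X Y)
  case 0
  then show ?case by simp
next
  case (Suc k)
  then obtain m where m: "n = Suc m" "k \<le> m" by (cases n) auto
  have "level_sum q k (\<lambda>w. X (i # w)) = level_sum q k (\<lambda>w. Y (i # w))" if "i < q" for i
    by (rule Suc.IH[OF _ m(2)]) (use Suc.prems m that in auto)
  then show ?case by simp
qed

lemma level_sum_add:
  "level_sum q k (\<lambda>w. X w + Y w) = level_sum q k X + level_sum q k Y"
  by (induction k arbitrary: X Y) (simp_all add: sum.distrib distrib_left)

text \<open>Level \<open>k\<close> has \<open>q\<^sup>k\<close> words, which cancels the weight \<open>q\<^bsup>-k/2\<^esup>\<close> of the vector against the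
  one in the normalization.\<close>

lemma level_sum_radial:
  assumes "q \<ge> 1"
  shows "level_sum q k (\<lambda>w. level_weight q ^ length w * h (length w)) = h k"
proof (induction k arbitrary: h)
  case 0
  then show ?case by simp
next
  case (Suc k)
  have "level_sum q k (\<lambda>w. level_weight q ^ Suc (length w) * h (Suc (length w))) =
      level_weight q * h (Suc k)"
    using Suc[of "\<lambda>l. level_weight q * h (Suc l)"] by (simp add: mult_ac)
  then show ?case
    using level_weight_square[OF assms] by (simp add: mult_ac)
qed

lemma sum_tree_ball_radial:
  "(\<Sum>w\<in>tree_ball q n. level_weight q ^ length w * (c (length w) * X w)) =
   (\<Sum>l\<le>n. c l * level_sum q l X)"
proof (induction n arbitrary: c X)
  case 0
  then show ?case by (simp add: tree_ball_0)
next
  case (Suc n)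
  have "(\<Sum>w\<in>tree_ball q n. level_weight q ^ Suc (length w) * (c (Suc (length w)) * X (i # w))) =
      (\<Sum>l\<le>n. level_weight q * c (Suc l) * level_sum q l (\<lambda>w. X (i # w)))" for i
    using Suc[of "\<lambda>l. level_weight q * c (Suc l)" "\<lambda>w. X (i # w)"] by (simp add: mult_ac)
  then have "(\<Sum>w\<in>tree_ball q (Suc n). level_weight q ^ length w * (c (length w) * X w)) =
      c 0 * X [] + (\<Sum>i<q. \<Sum>l\<le>n. level_weight q * c (Suc l) * level_sum q l (\<lambda>w. X (i # w)))"
    by (simp add: sum_tree_ball_Suc)
  also have "\<dots> = c 0 * X [] + (\<Sum>l\<le>n. c (Suc l) * level_sum q (Suc l) X)"
    by (subst sum.swap) (simp add: sum_distrib_left mult_ac)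
  finally show ?case by (simp add: sum.atMost_Suc_shift del: sum.atMost_Suc)
qed

lemma Gamma_apply_Nil:
  assumes "q \<ge> 1"
  shows "Gamma_apply q f n X [] = (\<Sum>l\<le>n. f (- int l) * level_sum q l X)"
proof -
  have "Gamma_apply q f n X [] =
    (\<Sum>w\<in>tree_ball q n. level_weight q ^ length w * (f (- int (length w)) * X w))"
    unfolding Gamma_apply_def mat_apply_def
    by (intro sum.cong) (use assms in \<open>auto simp: Gamma_tree_prefix tree_ball_length\<close>)
  then show ?thesis using sum_tree_ball_radial[where c = "\<lambda>l. f (- int l)"] by simp
qed

text \<open>The level sums intertwine the tree matrix with the Toeplitz matrix. In the inductive
  step the subtrees produce the columns \<open>l \<ge> 1\<close>, since \<open>f\<close> is evaluated at differences
  and both indices shift by one; the root produces the column \<open>l = 0\<close>.\<close>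

lemma level_sum_Gamma_apply:
  assumes "q \<ge> 1" "k \<le> n"
  shows "level_sum q k (Gamma_apply q f n X) = (\<Sum>l\<le>n. f (int k - int l) * level_sum q l X)"
  using assms(2)
proof (induction n arbitrary: k X)
  case 0
  then show ?case using Gamma_apply_Nil[OF assms(1)] by simp
next
  case (Suc n)
  show ?case
  proof (cases k)
    case 0
    then show ?thesis using Gamma_apply_Nil[OF assms(1)] by simp
  next
    case k: (Suc m)
    have m: "m \<le> n" using Suc.prems k by simp
    have "level_sum q m (\<lambda>w. Gamma_apply q f (Suc n) X (i # w)) =
        (\<Sum>l\<le>n. f (int m - int l) * level_sum q l (\<lambda>w. X (i # w))) +
        level_weight q * (f (int k) * X [])" if "i < q" for i
    proof -
      have "level_sum q m (\<lambda>w. Gamma_apply q f (Suc n) X (i # w)) =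
          level_sum q m (\<lambda>w. Gamma_apply q f n (\<lambda>u. X (i # u)) w +
            level_weight q ^ length w * (level_weight q * (f (1 + int (length w)) * X [])))"
        by (rule level_sum_cong[OF _ m]) (use that assms in \<open>simp add: Gamma_apply_Cons mult_ac\<close>)
      also have "\<dots> = level_sum q m (Gamma_apply q f n (\<lambda>u. X (i # u))) +
          level_weight q * (f (int k) * X [])"
        using level_sum_radial[OF assms(1), of m
            "\<lambda>l. level_weight q * (f (1 + int l) * X [])"] k
        by (simp add: level_sum_add)
      finally show ?thesis using Suc.IH[OF m] by simp
    qed
    then have "level_sum q k (Gamma_apply q f (Suc n) X) =
        level_weight q * (\<Sum>i<q. \<Sum>l\<le>n. f (int m - int l) * level_sum q l (\<lambda>w. X (i # w))) +
        (of_nat q * (level_weight q * level_weight q)) * (f (int k) * X [])"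
      by (simp add: k sum.distrib algebra_simps)
    also have "\<dots> = (\<Sum>l\<le>n. f (int m - int l) * level_sum q (Suc l) X) + f (int k) * X []"
      unfolding level_weight_square[OF assms(1)]
      by (subst sum.swap) (simp add: sum_distrib_left mult_ac)
    finally show ?thesis
      using k by (simp add: sum.atMost_Suc_shift del: sum.atMost_Suc)
  qed
qed

section \<open>The part orthogonal to radial vectors\<close>

text \<open>The level sums are the coordinates of the orthogonal projection of \<open>X\<close> to the radial
  vectors, so this is the squared distance of \<open>X\<close> to them.\<close>

definition nonradial_energy :: "nat \<Rightarrow> nat \<Rightarrow> (nat list \<Rightarrow> complex) \<Rightarrow> real" where
  "nonradial_energy q n X =
     (\<Sum>w\<in>tree_ball q n. (norm (X w))\<^sup>2) - (\<Sum>k\<le>n. (norm (level_sum q k X))\<^sup>2)"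

definition child_deviation :: "nat \<Rightarrow> (nat list \<Rightarrow> complex) \<Rightarrow> nat \<Rightarrow> nat \<Rightarrow> complex" where
  "child_deviation q X i k = level_sum q k (\<lambda>w. X (i # w)) -
     (\<Sum>j<q. level_sum q k (\<lambda>w. X (j # w))) / of_nat q"

text \<open>The variance identity for \<open>q\<close> numbers: the first term on the right is \<open>q\<close> times the
  squared modulus of their mean.\<close>

lemma sum_norm_deviation:
  fixes z :: "nat \<Rightarrow> complex"
  assumes "q \<ge> 1"
  shows "(\<Sum>i<q. (norm (z i))\<^sup>2) =
    (norm (level_weight q * (\<Sum>i<q. z i)))\<^sup>2 + (\<Sum>i<q. (norm (z i - (\<Sum>j<q. z j) / of_nat q))\<^sup>2)"
proof -
  define m where "m = (\<Sum>j<q. z j) / of_nat q"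
  have m: "(\<Sum>j<q. z j) = of_nat q * m" using assms by (simp add: m_def)
  have "(norm (z i - m))\<^sup>2 = (norm (z i))\<^sup>2 - 2 * Re (z i * cnj m) + (norm m)\<^sup>2" for i
    unfolding cmod_power2 by (simp add: power2_eq_square algebra_simps)
  then have "(\<Sum>i<q. (norm (z i - m))\<^sup>2) =
      (\<Sum>i<q. (norm (z i))\<^sup>2) - 2 * Re ((\<Sum>i<q. z i) * cnj m) + real q * (norm m)\<^sup>2"
    by (simp add: sum.distrib sum_subtractf sum_distrib_left sum_distrib_right)
  also have "Re ((\<Sum>i<q. z i) * cnj m) = real q * (norm m)\<^sup>2"
    unfolding m cmod_power2 by (simp add: power2_eq_square algebra_simps)
  finally have "(\<Sum>i<q. (norm (z i - m))\<^sup>2) = (\<Sum>i<q. (norm (z i))\<^sup>2) - real q * (norm m)\<^sup>2"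
    by simp
  moreover have "(norm (level_weight q * (\<Sum>i<q. z i)))\<^sup>2 = real q * (norm m)\<^sup>2"
    using assms unfolding m level_weight_def
    by (simp add: norm_mult norm_divide power_mult_distrib power_divide power2_eq_square)
  ultimately show ?thesis unfolding m_def by simp
qed

text \<open>The level sums of \<open>X\<close> from level 1 on are, up to the factor \<open>sqrt q\<close>, the means of the
  level sums of the subtrees. Subtracting their squares replaces the squares of the level
  sums of the subtrees by squared deviations.\<close>

lemma nonradial_energy_Suc:
  assumes "q \<ge> 1"
  shows "nonradial_energy q (Suc n) X =
    (\<Sum>i<q. nonradial_energy q n (\<lambda>w. X (i # w)) + (\<Sum>k\<le>n. (norm (child_deviation q X i k))\<^sup>2))"
proof -
  have "(\<Sum>k\<le>n. (norm (level_sum q (Suc k) X))\<^sup>2) =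
      (\<Sum>k\<le>n. (\<Sum>i<q. (norm (level_sum q k (\<lambda>w. X (i # w))))\<^sup>2) -
        (\<Sum>i<q. (norm (child_deviation q X i k))\<^sup>2))"
    using sum_norm_deviation[OF assms, of "\<lambda>i. level_sum q _ (\<lambda>w. X (i # w))"]
    by (intro sum.cong) (simp_all add: child_deviation_def)
  also have "\<dots> = (\<Sum>i<q. (\<Sum>k\<le>n. (norm (level_sum q k (\<lambda>w. X (i # w))))\<^sup>2) -
      (\<Sum>k\<le>n. (norm (child_deviation q X i k))\<^sup>2))"
    unfolding sum_subtractf[symmetric] by (rule sum.swap)
  finally show ?thesis
    unfolding nonradial_energy_def sum_tree_ball_Suc sum.atMost_Suc_shift
    by (simp add: sum_subtractf sum.distrib)
qed

lemma nonradial_energy_nonneg: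
  assumes "q \<ge> 1"
  shows "nonradial_energy q n X \<ge> 0"
proof (induction n arbitrary: X)
  case 0
  then show ?case by (simp add: nonradial_energy_def tree_ball_0)
next
  case (Suc n)
  then show ?case
    unfolding nonradial_energy_Suc[OF assms] by (intro sum_nonneg add_nonneg_nonneg) auto
qed

text \<open>The radial perturbation \<open>h\<close> makes the induction possible: seen from a subtree, the
  contribution of the root is such a perturbation. It is the same for all subtrees, hence
  cancels in the deviations from the mean, on which the matrix therefore acts as the
  Toeplitz matrix of smaller size.\<close>

lemma nonradial_energy_Gamma_le:
  assumes q: "q \<ge> 1"
    and T: "\<And>m x. m \<le> n \<Longrightarrow>
      (\<Sum>k\<le>m. (norm (\<Sum>l\<le>m. f (int k - int l) * x l))\<^sup>2) \<le> D * (\<Sum>k\<le>m. (norm (x k))\<^sup>2)"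
    and Y: "\<And>w. w \<in> tree_ball q n \<Longrightarrow>
      Y w = Gamma_apply q f n X w + level_weight q ^ length w * h (length w)"
  shows "nonradial_energy q n Y \<le> D * nonradial_energy q n X"
  using T Y
proof (induction n arbitrary: X Y h)
  case 0
  then show ?case by (simp add: nonradial_energy_def tree_ball_0)
next
  case (Suc n)
  \<comment> \<open>The perturbation that all subtrees receive: the root value times a coefficient of
    \<open>f\<close>, and \<open>h\<close> moved by one level.\<close>
  define h' where
    "h' l = level_weight q * (f (1 + int l) * X [] + h (Suc l))" for l
  have Y': "Y (i # w) = Gamma_apply q f n (\<lambda>u. X (i # u)) w +
      level_weight q ^ length w * h' (length w)" if "i < q" "w \<in> tree_ball q n" for i w
    using Suc.prems(2)[of "i # w"] that q
    by (simp add: Gamma_apply_Cons h'_def algebra_simps)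
  have IH: "nonradial_energy q n (\<lambda>w. Y (i # w)) \<le> D * nonradial_energy q n (\<lambda>w. X (i # w))"
    if "i < q" for i
    by (rule Suc.IH[OF _ Y'[OF that]]) (use Suc.prems(1) in auto)
  have ls: "level_sum q k (\<lambda>w. Y (i # w)) =
      (\<Sum>l\<le>n. f (int k - int l) * level_sum q l (\<lambda>w. X (i # w))) + h' k"
    if "i < q" "k \<le> n" for i k
  proof -
    have "level_sum q k (\<lambda>w. Y (i # w)) =
      level_sum q k (\<lambda>w. Gamma_apply q f n (\<lambda>u. X (i # u)) w +
        level_weight q ^ length w * h' (length w))"
      by (rule level_sum_cong[OF _ that(2)]) (use Y' that in simp)
    then show ?thesis
      using level_sum_Gamma_apply[OF q that(2)] level_sum_radial[OF q, of k h']
      by (simp add: level_sum_add)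
  qed
  have dev: "child_deviation q Y i k = (\<Sum>l\<le>n. f (int k - int l) * child_deviation q X i l)"
    if "i < q" "k \<le> n" for i k
  proof -
    have "(\<Sum>j<q. level_sum q k (\<lambda>w. Y (j # w))) / of_nat q =
      (\<Sum>j<q. \<Sum>l\<le>n. f (int k - int l) * level_sum q l (\<lambda>w. X (j # w))) / of_nat q + h' k"
      using q that(2) by (simp add: ls sum.distrib add_divide_distrib)
    also have "(\<Sum>j<q. \<Sum>l\<le>n. f (int k - int l) * level_sum q l (\<lambda>w. X (j # w))) / of_nat q =
      (\<Sum>l\<le>n. f (int k - int l) * ((\<Sum>j<q. level_sum q l (\<lambda>w. X (j # w))) / of_nat q))"
      by (subst sum.swap) (simp add: sum_distrib_left sum_divide_distrib)
    finally show ?thesis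
      using that by (simp add: child_deviation_def ls right_diff_distrib sum_subtractf)
  qed
  have "(\<Sum>k\<le>n. (norm (child_deviation q Y i k))\<^sup>2) \<le>
      D * (\<Sum>k\<le>n. (norm (child_deviation q X i k))\<^sup>2)" if "i < q" for i
    using Suc.prems(1)[of n "child_deviation q X i"] dev[OF that] by simp
  then show ?case
    unfolding nonradial_energy_Suc[OF q] sum_distrib_left
    using IH by (intro sum_mono) (auto simp: distrib_left sum_distrib_left intro!: add_mono)
qed

section \<open>Operator norms\<close>

lemma euclid_norm_square: "(euclid_norm I x)\<^sup>2 = (\<Sum>i\<in>I. (norm (x i))\<^sup>2)"
  by (simp add: euclid_norm_def L2_set_def sum_nonneg)

lemma euclid_norm_nonneg [simp]: "euclid_norm I x \<ge> 0"
  by (simp add: euclid_norm_def)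

lemma euclid_norm_zero [simp]: "euclid_norm I (\<lambda>_. 0) = 0"
  by (simp add: euclid_norm_def L2_set_def)

lemma euclid_norm_scale: "euclid_norm I (\<lambda>i. of_real c * x i) = \<bar>c\<bar> * euclid_norm I x"
  unfolding euclid_norm_def by (simp add: norm_mult L2_set_right_distrib)

lemma op_norm_bdd_above:
  assumes "finite I"
  shows "bdd_above {euclid_norm I (mat_apply I A x) | x. euclid_norm I x \<le> 1}"
proof -
  have "euclid_norm I (mat_apply I A x) \<le> (\<Sum>i\<in>I. \<Sum>j\<in>I. norm (A i j))"
    if "euclid_norm I x \<le> 1" for x
  proof -
    have x: "norm (x j) \<le> 1" if "j \<in> I" for j
      using member_le_L2_set[OF assms that, of "\<lambda>i. norm (x i)"] \<open>euclid_norm I x \<le> 1\<close>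
      by (simp add: euclid_norm_def)
    have "euclid_norm I (mat_apply I A x) \<le> (\<Sum>i\<in>I. norm (mat_apply I A x i))"
      unfolding euclid_norm_def by (rule L2_set_le_sum) simp
    also have "\<dots> \<le> (\<Sum>i\<in>I. \<Sum>j\<in>I. norm (A i j))"
      unfolding mat_apply_def
    proof (intro sum_mono order.trans[OF norm_sum])
      fix i j assume "j \<in> I"
      then show "norm (A i j * x j) \<le> norm (A i j)"
        using x mult_left_mono[of "norm (x j)" 1 "norm (A i j)"] by (simp add: norm_mult)
    qed
    finally show ?thesis .
  qed
  then show ?thesis by (auto intro!: bdd_aboveI)
qed

lemma op_norm_nonneg:
  assumes "finite I"
  shows "op_norm I A \<ge> 0"
proof -
  have "euclid_norm I (mat_apply I A (\<lambda>_. 0)) \<le> op_norm I A"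
    unfolding op_norm_def
    by (rule cSup_upper[OF _ op_norm_bdd_above[OF assms]])
      (auto intro!: exI[of _ "\<lambda>_. 0"])
  then show ?thesis using euclid_norm_nonneg order.trans by blast
qed

lemma euclid_norm_mat_apply_le:
  assumes "finite I"
  shows "euclid_norm I (mat_apply I A x) \<le> op_norm I A * euclid_norm I x"
proof (cases "euclid_norm I x = 0")
  case True
  then have "x i = 0" if "i \<in> I" for i
    using that assms by (simp add: euclid_norm_def L2_set_eq_0_iff)
  then have "mat_apply I A x i = 0" for i
    by (simp add: mat_apply_def)
  then have "mat_apply I A x = (\<lambda>_. 0)" by blast
  then show ?thesis using True by simp
next
  case False
  then have pos: "euclid_norm I x > 0" by (simp add: less_le)
  define c where "c = 1 / euclid_norm I x"
  have c: "c > 0" using pos by (simp add: c_def)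
  let ?y = "\<lambda>i. of_real c * x i"
  have "euclid_norm I ?y \<le> 1"
    unfolding euclid_norm_scale using False c by (simp add: c_def)
  then have "euclid_norm I (mat_apply I A ?y) \<le> op_norm I A"
    unfolding op_norm_def by (intro cSup_upper[OF _ op_norm_bdd_above[OF assms]]) auto
  moreover have "mat_apply I A ?y = (\<lambda>i. of_real c * mat_apply I A x i)"
    by (simp add: mat_apply_def sum_distrib_left mult_ac fun_eq_iff)
  ultimately have "c * euclid_norm I (mat_apply I A x) \<le> op_norm I A"
    using c by (simp add: euclid_norm_scale)
  then show ?thesis
    using pos by (simp add: c_def divide_le_eq)
qed

lemma op_norm_le:
  assumes "C \<ge> 0"
    and "\<And>x. (euclid_norm I (mat_apply I A x))\<^sup>2 \<le> C\<^sup>2 * (euclid_norm I x)\<^sup>2"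
  shows "op_norm I A \<le> C"
  unfolding op_norm_def
proof (rule cSup_least)
  have "euclid_norm I (\<lambda>_. 0) \<le> 1" by simp
  then show "{euclid_norm I (mat_apply I A x) | x. euclid_norm I x \<le> 1} \<noteq> {}" by blast
next
  fix y assume "y \<in> {euclid_norm I (mat_apply I A x) | x. euclid_norm I x \<le> 1}"
  then obtain x where x: "y = euclid_norm I (mat_apply I A x)" "euclid_norm I x \<le> 1" by auto
  have "y\<^sup>2 \<le> (C * euclid_norm I x)\<^sup>2"
    using assms(2)[of x] x by (simp add: power_mult_distrib)
  then have "y \<le> C * euclid_norm I x"
    by (rule power2_le_imp_le) (use assms(1) in simp)
  also have "\<dots> \<le> C" using x(2) assms(1) by (simp add: mult_left_le)
  finally show "y \<le> C" .
qed

section \<open>Comparison of the two norms\<close>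

text \<open>A vector on \<open>{0..m}\<close> is extended by zero, which exhibits \<^term>\<open>toeplitz f\<close> on
  \<open>{0..m}\<close> as a corner of the larger matrix.\<close>

lemma toeplitz_truncation_bound:
  assumes "m \<le> n"
  shows "(\<Sum>k\<le>m. (norm (\<Sum>l\<le>m. f (int k - int l) * x l))\<^sup>2)
    \<le> (op_norm {0..n} (toeplitz f))\<^sup>2 * (\<Sum>k\<le>m. (norm (x k))\<^sup>2)"
proof -
  define y where "y l = (if l \<le> m then x l else 0)" for l
  have sub: "{..m} \<subseteq> {0..n}" using assms by auto
  have T: "mat_apply {0..n} (toeplitz f) y k = (\<Sum>l\<le>m. f (int k - int l) * x l)" for k
    unfolding mat_apply_def toeplitz_def
    by (rule sum.mono_neutral_cong_right) (use sub in \<open>auto simp: y_def\<close>)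
  have "(\<Sum>k\<le>m. (norm (\<Sum>l\<le>m. f (int k - int l) * x l))\<^sup>2)
      \<le> (euclid_norm {0..n} (mat_apply {0..n} (toeplitz f) y))\<^sup>2"
    unfolding euclid_norm_square T by (rule sum_mono2) (use sub in auto)
  also have "\<dots> \<le> (op_norm {0..n} (toeplitz f) * euclid_norm {0..n} y)\<^sup>2"
    by (rule power_mono[OF euclid_norm_mat_apply_le]) auto
  also have "(euclid_norm {0..n} y)\<^sup>2 = (\<Sum>k\<le>m. (norm (x k))\<^sup>2)"
    unfolding euclid_norm_square
    by (rule sum.mono_neutral_cong_right) (use sub in \<open>auto simp: y_def\<close>)
  then have "(op_norm {0..n} (toeplitz f) * euclid_norm {0..n} y)\<^sup>2 =
      (op_norm {0..n} (toeplitz f))\<^sup>2 * (\<Sum>k\<le>m. (norm (x k))\<^sup>2)"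
    by (simp add: power_mult_distrib)
  finally show ?thesis .
qed

lemma op_norm_Gamma_le:
  assumes q: "q \<ge> 1"
  shows "op_norm (tree_ball q n) (Gamma_tree q f) \<le> op_norm {0..n} (toeplitz f)"
proof (rule op_norm_le)
  show "op_norm {0..n} (toeplitz f) \<ge> 0" by (rule op_norm_nonneg) simp
next
  fix X
  let ?D = "(op_norm {0..n} (toeplitz f))\<^sup>2"
  let ?Y = "Gamma_apply q f n X"
  have "(\<Sum>w\<in>tree_ball q n. (norm (?Y w))\<^sup>2) =
      nonradial_energy q n ?Y + (\<Sum>k\<le>n. (norm (level_sum q k ?Y))\<^sup>2)"
    by (simp add: nonradial_energy_def)
  also have "\<dots> \<le> ?D * nonradial_energy q n X + ?D * (\<Sum>k\<le>n. (norm (level_sum q k X))\<^sup>2)"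
  proof (rule add_mono)
    show "nonradial_energy q n ?Y \<le> ?D * nonradial_energy q n X"
      by (rule nonradial_energy_Gamma_le[OF q toeplitz_truncation_bound, where h = "\<lambda>_. 0"]) auto
    show "(\<Sum>k\<le>n. (norm (level_sum q k ?Y))\<^sup>2) \<le> ?D * (\<Sum>k\<le>n. (norm (level_sum q k X))\<^sup>2)"
      using toeplitz_truncation_bound[of n n f "\<lambda>l. level_sum q l X"]
      by (simp add: level_sum_Gamma_apply[OF q])
  qed
  also have "\<dots> = ?D * (\<Sum>w\<in>tree_ball q n. (norm (X w))\<^sup>2)"
    by (simp add: nonradial_energy_def algebra_simps)
  finally show "(euclid_norm (tree_ball q n) (mat_apply (tree_ball q n) (Gamma_tree q f) X))\<^sup>2
      \<le> ?D * (euclid_norm (tree_ball q n) X)\<^sup>2"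
    by (simp add: euclid_norm_square Gamma_apply_def)
qed

lemma norm_square_radial:
  assumes q: "q \<ge> 1"
  shows "(\<Sum>w\<in>tree_ball q n. (norm (level_weight q ^ length w * x (length w)))\<^sup>2) =
    (\<Sum>k\<le>n. (norm (x k))\<^sup>2)"
proof (induction n arbitrary: x)
  case 0
  then show ?case by (simp add: tree_ball_0)
next
  case (Suc n)
  have "(\<Sum>w\<in>tree_ball q n. (norm (level_weight q ^ Suc (length w) * x (Suc (length w))))\<^sup>2) =
      (\<Sum>k\<le>n. (norm (level_weight q * x (Suc k)))\<^sup>2)"
    using Suc[of "\<lambda>l. level_weight q * x (Suc l)"] by (simp add: mult_ac)
  also have "\<dots> = (\<Sum>k\<le>n. (norm (x (Suc k)))\<^sup>2) / real q"
    by (simp add: norm_mult level_weight_def norm_divide power_divide power_mult_distrib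
        sum_divide_distrib)
  finally show ?case
    using q by (simp add: sum_tree_ball_Suc sum.atMost_Suc_shift del: sum.atMost_Suc)
qed

text \<open>The lift of \<open>x\<close> to a radial vector has the same norm as \<open>x\<close>; taking level sums, which does
  not increase norms, turns its image under the tree matrix into the image of \<open>x\<close> under the
  Toeplitz matrix.\<close>

lemma op_norm_toeplitz_le:
  assumes q: "q \<ge> 1"
  shows "op_norm {0..n} (toeplitz f) \<le> op_norm (tree_ball q n) (Gamma_tree q f)"
proof (rule op_norm_le)
  show "op_norm (tree_ball q n) (Gamma_tree q f) \<ge> 0" by (rule op_norm_nonneg) simp
next
  fix x :: "nat \<Rightarrow> complex"
  let ?B = "tree_ball q n" and ?G = "op_norm (tree_ball q n) (Gamma_tree q f)"
  define X where "X w = level_weight q ^ length w * x (length w)" for w :: "nat list"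
  have lsX: "level_sum q k X = x k" for k
    unfolding X_def by (rule level_sum_radial[OF q])
  have "(euclid_norm {0..n} (mat_apply {0..n} (toeplitz f) x))\<^sup>2 =
      (\<Sum>k\<le>n. (norm (level_sum q k (Gamma_apply q f n X)))\<^sup>2)"
    by (simp add: euclid_norm_square mat_apply_def toeplitz_def level_sum_Gamma_apply[OF q] lsX
        atLeast0AtMost)
  also have "\<dots> \<le> (euclid_norm ?B (Gamma_apply q f n X))\<^sup>2"
    using nonradial_energy_nonneg[OF q, of n "Gamma_apply q f n X"]
    by (simp add: nonradial_energy_def euclid_norm_square)
  also have "\<dots> \<le> (?G * euclid_norm ?B X)\<^sup>2"
    unfolding Gamma_apply_def by (rule power_mono[OF euclid_norm_mat_apply_le]) auto
  also have "(euclid_norm ?B X)\<^sup>2 = (euclid_norm {0..n} x)\<^sup>2"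
    unfolding euclid_norm_square X_def norm_square_radial[OF q] by (simp add: atLeast0AtMost)
  then have "(?G * euclid_norm ?B X)\<^sup>2 = ?G\<^sup>2 * (euclid_norm {0..n} x)\<^sup>2"
    by (simp add: power_mult_distrib)
  finally show "(euclid_norm {0..n} (mat_apply {0..n} (toeplitz f) x))\<^sup>2
      \<le> ?G\<^sup>2 * (euclid_norm {0..n} x)\<^sup>2" .
qed

lemma hermitian_Gamma_tree:
  assumes "hermitian_on {0..n} (toeplitz f)"
  shows "hermitian_on (tree_ball q n) (Gamma_tree q f)"
  unfolding hermitian_on_def
proof (intro ballI)
  fix \<sigma> \<tau> assume "\<sigma> \<in> tree_ball q n" "\<tau> \<in> tree_ball q n"
  then have "level q \<sigma> \<in> {0..n}" "level q \<tau> \<in> {0..n}" by (simp_all add: tree_ball_def)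
  then have "f (int (level q \<tau>) - int (level q \<sigma>)) = cnj (f (int (level q \<sigma>) - int (level q \<tau>)))"
    using assms unfolding hermitian_on_def toeplitz_def by blast
  moreover have "(\<tau>, \<sigma>) \<in> comparable q \<longleftrightarrow> (\<sigma>, \<tau>) \<in> comparable q"
    by (auto simp: comparable_def)
  ultimately show "Gamma_tree q f \<tau> \<sigma> = cnj (Gamma_tree q f \<sigma> \<tau>)"
    by (simp add: Gamma_tree_def tree_dist_commute[of q \<tau> \<sigma>] indicator_def)
qed

theorem theorem1p16:
  fixes q n :: nat and f :: fourier_series
  assumes "q \<ge> 2" and "n \<ge> 1"
  shows "((\<forall>k. \<bar>k\<bar> \<le> int n \<longrightarrow> f k \<in> \<real>\<^sub>\<ge>\<^sub>0) \<or>
          hermitian_on {0..n} (toeplitz f) \<or>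
          f \<in> H_infty
            \<longrightarrow> op_norm (tree_ball q n) (Gamma_tree q f) = op_norm {0..n} (toeplitz f)) \<and>
         (hermitian_on {0..n} (toeplitz f) \<longrightarrow>
            hermitian_on (tree_ball q n) (Gamma_tree q f))"
proof -
  have "q \<ge> 1" using assms(1) by simp
  then have "op_norm (tree_ball q n) (Gamma_tree q f) = op_norm {0..n} (toeplitz f)"
    by (intro antisym op_norm_Gamma_le op_norm_toeplitz_le)
  then show ?thesis using hermitian_Gamma_tree by blast
qed

end
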